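(* There is a constant $C>0$ such that for every $d>1$ and every $q\in\mathbb N$, $q\ge1$, a $q$-toast cannot be constructed on $\mathbb{Z}^d$ by a uniform local algorithm with uniform complexity $C/\varepsilon$. Here, by constructing a $q$-toast $\mathcal D$ we mean that the coding radius of each node $u$ is such that $u$ can describe the minimal toast piece $D\in\mathcal D$ with $u\in D$.
   Context: $\mathbb{Z}^d$ denotes the infinite grid: the Cayley graph of the group $\mathbb{Z}^d$ with respect to the standard generators, each edge being oriented and labelled by its generator; $d(\cdot,\cdot)$ is graph distance. For $q>0$, a $q$-toast on $\mathbb{Z}^d$ is a collection $\mathcal D$ of finite connected subsets (pieces) of $\mathbb{Z}^d$ such that (i) for all $g,h\in\mathbb{Z}^d$ there is $D\in\mathcal D$ with $g,h\in D$, and (ii) if $D,E\in\mathcal D$ and $d(\partial D,\partial E)\le q$ then $D=E$, where $\partial D$ is the boundary of $D$ (vertices of $D$ with a neighbor outside $D$). A uniform local algorithm is run on $\mathbb{Z}^d$ whose vertices carry independent uniform random labels from $[0,1]$: each vertex explores balls of increasing radius around itself until the labelled ball (up to isomorphism, not depending on its position) belongs to a prescribed collection, and then it outputs a value that is a measurable function of that labelled ball. It constructs a $q$-toast if with probability $1$ there is a $q$-toast $\mathcal D$ such that every vertex $u$ outputs (as a subset positioned relative to $u$) the minimal piece of $\mathcal D$ containing $u$. The coding radius $R$ is the random minimal radius a vertex explores before output, and the algorithm has uniform complexity $t(\varepsilon)$ if $\mathrm P(R>t(\varepsilon))\le\varepsilon$ for all sufficiently small $\varepsilon>0$. *)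

theory Defs
  imports "HOL-Probability.Probability" "HOL-Library.Function_Algebras"
begin

text \<open>
  The dimension is quantified inside the statement, so \<open>\<int>\<^sup>d\<close> is the set of functions
  \<open>nat \<Rightarrow> int\<close> that vanish outside \<open>{..<d}\<close>; the group structure is the pointwise one.
\<close>

type_synonym vertex = "nat \<Rightarrow> int"

definition grid :: "nat \<Rightarrow> vertex set" where
  "grid d = {x. \<forall>i\<ge>d. x i = 0}"

definition generator :: "nat \<Rightarrow> vertex" where
  "generator i = (\<lambda>j. if j = i then 1 else 0)"

definition grid_edges :: "nat \<Rightarrow> (vertex \<times> vertex) set" where
  "grid_edges d = {(x, y). x \<in> grid d \<and> y \<in> grid d \<and>
                     (\<exists>i<d. y = x + generator i \<or> x = y + generator i)}"

definition grid_dist :: "nat \<Rightarrow> vertex \<Rightarrow> vertex \<Rightarrow> nat" where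
  "grid_dist d x y = (LEAST n. (x, y) \<in> grid_edges d ^^ n)"

definition grid_ball :: "nat \<Rightarrow> vertex \<Rightarrow> nat \<Rightarrow> vertex set" where
  "grid_ball d u r = {v \<in> grid d. grid_dist d u v \<le> r}"

definition grid_boundary :: "nat \<Rightarrow> vertex set \<Rightarrow> vertex set" where
  "grid_boundary d D = {x \<in> D. \<exists>y. (x, y) \<in> grid_edges d \<and> y \<notin> D}"

definition grid_connected :: "nat \<Rightarrow> vertex set \<Rightarrow> bool" where
  "grid_connected d D \<longleftrightarrow> (\<forall>x\<in>D. \<forall>y\<in>D. (x, y) \<in> (grid_edges d \<inter> D \<times> D)\<^sup>*)"

definition toast :: "nat \<Rightarrow> nat \<Rightarrow> vertex set set \<Rightarrow> bool" where
  "toast d q \<D> \<longleftrightarrow>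
     (\<forall>D\<in>\<D>. D \<subseteq> grid d \<and> finite D \<and> grid_connected d D) \<and>
     (\<forall>g\<in>grid d. \<forall>h\<in>grid d. \<exists>D\<in>\<D>. g \<in> D \<and> h \<in> D) \<and>
     (\<forall>D\<in>\<D>. \<forall>E\<in>\<D>.
        (\<exists>x\<in>grid_boundary d D. \<exists>y\<in>grid_boundary d E. grid_dist d x y \<le> q) \<longrightarrow> D = E)"

text \<open>
  Minimality is with respect to inclusion. Pieces may have holes, so two pieces containing
  \<open>u\<close> need not be nested; in that case every inclusion-minimal one is accepted.
\<close>

definition minimal_piece :: "vertex set set \<Rightarrow> vertex \<Rightarrow> vertex set \<Rightarrow> bool" where
  "minimal_piece \<D> u D \<longleftrightarrow>
     D \<in> \<D> \<and> u \<in> D \<and> (\<forall>E\<in>\<D>. u \<in> E \<longrightarrow> E \<subseteq> D \<longrightarrow> E = D)"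

text \<open>Independent uniform labels from \<open>[0,1]\<close> on the vertices in \<open>V\<close>.\<close>

definition labelling :: "vertex set \<Rightarrow> (vertex \<Rightarrow> real) measure" where
  "labelling V = (\<Pi>\<^sub>M v\<in>V. uniform_measure lborel {0..1})"

text \<open>
  A rooted isomorphism between balls of the grid that respects the orientation and the
  generator labels of the edges is a translation. Hence the isomorphism type of the labelled
  ball of radius \<open>r\<close> around \<open>u\<close> is its translate to the origin.
\<close>

definition labelled_ball :: "nat \<Rightarrow> (vertex \<Rightarrow> real) \<Rightarrow> vertex \<Rightarrow> nat \<Rightarrow> vertex \<Rightarrow> real" where
  "labelled_ball d \<omega> u r = (\<lambda>x\<in>grid_ball d 0 r. \<omega> (u + x))"

text \<open>
  An algorithm consists of, for every radius \<open>r\<close>, the collection \<open>S r\<close> of labelled balls of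
  radius \<open>r\<close> at which a vertex stops, and the output rule \<open>f r\<close> with values in \<open>N\<close>. Only the
  values of \<open>f r\<close> on \<open>S r\<close> matter.
\<close>

definition uniform_local_algorithm ::
  "nat \<Rightarrow> 'b measure \<Rightarrow> (nat \<Rightarrow> (vertex \<Rightarrow> real) set) \<Rightarrow> (nat \<Rightarrow> (vertex \<Rightarrow> real) \<Rightarrow> 'b) \<Rightarrow> bool"
where
  "uniform_local_algorithm d N S f \<longleftrightarrow>
     (\<forall>r. S r \<in> sets (labelling (grid_ball d 0 r)) \<and>
          f r \<in> labelling (grid_ball d 0 r) \<rightarrow>\<^sub>M N)"

text \<open>The coding radius is \<open>\<infinity>\<close> if the vertex never stops.\<close>

definition coding_radius ::
  "nat \<Rightarrow> (nat \<Rightarrow> (vertex \<Rightarrow> real) set) \<Rightarrow> (vertex \<Rightarrow> real) \<Rightarrow> vertex \<Rightarrow> enat"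
where
  "coding_radius d S \<omega> u = (INF r\<in>{r. labelled_ball d \<omega> u r \<in> S r}. enat r)"

text \<open>By translation invariance, the law of the coding radius is the same at every vertex.\<close>

definition has_uniform_complexity ::
  "nat \<Rightarrow> (nat \<Rightarrow> (vertex \<Rightarrow> real) set) \<Rightarrow> (real \<Rightarrow> real) \<Rightarrow> bool"
where
  "has_uniform_complexity d S t \<longleftrightarrow>
     (\<forall>\<^sub>F \<epsilon> in at_right 0.
        \<P>(\<omega> in labelling (grid d). ereal (t \<epsilon>) < ereal_of_enat (coding_radius d S \<omega> 0)) \<le> \<epsilon>)"

text \<open>The output of \<open>u\<close> describes the piece relative to \<open>u\<close>; \<open>(+) u ` D\<close> moves it into place.\<close>

definition constructs_toast ::
  "nat \<Rightarrow> nat \<Rightarrow> (nat \<Rightarrow> (vertex \<Rightarrow> real) set) \<Rightarrow>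
   (nat \<Rightarrow> (vertex \<Rightarrow> real) \<Rightarrow> vertex set) \<Rightarrow> bool"
where
  "constructs_toast d q S f \<longleftrightarrow>
     (AE \<omega> in labelling (grid d). \<exists>\<D>. toast d q \<D> \<and>
        (\<forall>u\<in>grid d. \<exists>r. coding_radius d S \<omega> u = enat r \<and>
           minimal_piece \<D> u ((+) u ` f r (labelled_ball d \<omega> u r))))"

end

(*
  The minimal piece seen by a vertex cannot be much wider than twice its coding radius. Otherwise
  some wide finite set F is output with positive probability after exploring radius r; take two
  boundary points of F whose difference w exceeds 2r in the first coordinate. By independence,
  0 and w then output F and its translate w + F with positive probability, but these share a
  boundary point.

  On the other hand, the minimal pieces of the vertices of a segment of length L cannot all be
  narrower than L: after filling holes, connected pieces with separated boundaries in a plane are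
  nested or disjoint, and a maximal filled piece along the segment must contain all of it. So some
  vertex of the segment has coding radius at least L/2, and by translation invariance
  P(R >= k) >= 1/(2k+1), which is incompatible with P(R > C/eps) <= eps for C < 1/2.
*)
theory Submission
  imports Defs
begin

section \<open>Mod 2 potentials of edge labellings of the line and the plane\<close>

text \<open>The value \<open>f a\<close> is read as a mod 2 label of the edge from \<open>a\<close>
  to \<open>a + 1\<close>. The potential at \<open>a\<close> is the parity of the number of labelled
  edges between 0 and \<open>a\<close>.\<close>

lemma int_bool_potential:
  fixes f :: "int \<Rightarrow> bool"
  shows "\<exists>X :: int \<Rightarrow> bool. \<forall>a. f a = (X a \<noteq> X (a + 1))"
proof -
  define g :: "int \<Rightarrow> nat" where "g = (\<lambda>i. of_bool (f i))"
  \<comment> \<open>One of the two intervals is always empty, so one formula serves both sides of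
    0.\<close>
  define s where "s = (\<lambda>a. sum g {0..<a} + sum g {a..<0})"
  have "f a = (odd (s a) \<noteq> odd (s (a + 1)))" for a
  proof (cases "a \<ge> 0")
    case True
    then have "{0..<a + 1} = insert a {0..<a}" by auto
    then have "s (a + 1) = g a + s a" using True by (simp add: s_def)
    then show ?thesis by (simp add: g_def)
  next
    case False
    then have "{a..<0} = insert a {a + 1..<0}" by auto
    then have "s a = g a + s (a + 1)" using False by (simp add: s_def)
    then show ?thesis by (simp add: g_def)
  qed
  then have "\<forall>a. f a = (odd (s a) \<noteq> odd (s (a + 1)))" by blast
  then show ?thesis by (rule exI[where x = "\<lambda>a. odd (s a)"])
qed

text \<open>A discrete Poincare lemma mod 2: \<open>h\<close> labels horizontal edges,
  \<open>v\<close> vertical ones, and labels that sum to zero around every unit square have a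
  potential. It is obtained by summing along row 0 and then along the columns; the square condition
  carries the horizontal equation from row to row.\<close>

lemma planar_bool_potential:
  fixes h v :: "int \<Rightarrow> int \<Rightarrow> bool"
  assumes square: "\<And>a b. (h a b \<noteq> v (a + 1) b) = (v a b \<noteq> h a (b + 1))"
  shows "\<exists>X :: int \<Rightarrow> int \<Rightarrow> bool. \<forall>a b. h a b = (X a b \<noteq> X (a + 1) b) \<and> v a b = (X a b \<noteq> X a (b + 1))"
proof -
  obtain X0 :: "int \<Rightarrow> bool" where X0: "\<forall>a. h a 0 = (X0 a \<noteq> X0 (a + 1))"
    using int_bool_potential[of "\<lambda>a. h a 0"] ..
  have "\<forall>a. \<exists>Y :: int \<Rightarrow> bool. \<forall>b. v a b = (Y b \<noteq> Y (b + 1))"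
    by (intro allI int_bool_potential)
  then obtain Y :: "int \<Rightarrow> int \<Rightarrow> bool" where Y: "\<forall>a b. v a b = (Y a b \<noteq> Y a (b + 1))"
    by (rule choice[THEN exE])
  \<comment> \<open>Each column potential is normalised so that it agrees with \<open>X0\<close> in
    row 0; \<open>\<noteq>\<close> serves as addition mod 2.\<close>
  define X where "X = (\<lambda>a b. X0 a \<noteq> (Y a b \<noteq> Y a (0::int)))"
  have v: "v a b = (X a b \<noteq> X a (b + 1))" for a b
    using Y[rule_format, of a b] by (simp add: X_def) argo
  have "h a b = (X a b \<noteq> X (a + 1) b)" for a b
  proof (induction b rule: int_induct[where k = 0])
    case base
    show ?case using X0 by (simp add: X_def)
  next
    case (step1 i)
    then show ?case using square[of a i] v[of a i] v[of "a + 1" i] by argo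
  next
    case (step2 i)
    then show ?case using square[of a "i - 1"] v[of a "i - 1"] v[of "a + 1" "i - 1"] by simp argo
  qed
  with v show ?thesis by (intro exI[where x = X]) simp
qed

section \<open>Connectivity and hole filling in the plane\<close>

definition adj :: "int \<times> int \<Rightarrow> int \<times> int \<Rightarrow> bool" where
  "adj x y \<longleftrightarrow> \<bar>fst x - fst y\<bar> + \<bar>snd x - snd y\<bar> = 1"

text \<open>The closure is reflexive at every point, even outside \<open>A\<close>; membership of
  the start point is therefore stated separately wherever it matters.\<close>

definition reach :: "(int \<times> int) set \<Rightarrow> int \<times> int \<Rightarrow> int \<times> int \<Rightarrow> bool" where
  "reach A = (\<lambda>x y. adj x y \<and> x \<in> A \<and> y \<in> A)\<^sup>*\<^sup>*"

definition rim :: "(int \<times> int) set \<Rightarrow> (int \<times> int) set" where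
  "rim K = {x \<in> K. \<exists>y. adj x y \<and> y \<notin> K}"

text \<open>
  For \<open>p\<close> above all pieces under consideration, the complement of the outer region is \<open>K\<close> with its
  holes filled.
\<close>

definition outer_region :: "(int \<times> int) set \<Rightarrow> int \<times> int \<Rightarrow> (int \<times> int) set" where
  "outer_region K p = {x. x \<notin> K \<and> reach (- K) x p}"

lemma adj_sym: "adj x y \<Longrightarrow> adj y x"
  by (auto simp: adj_def)

lemma adj_cases:
  assumes "adj x y"
  obtains a b where "x = (a, b)" "y = (a + 1, b)" | a b where "y = (a, b)" "x = (a + 1, b)"
    | a b where "x = (a, b)" "y = (a, b + 1)" | a b where "y = (a, b)" "x = (a, b + 1)"
proof -
  obtain a b c d where xy: "x = (a, b)" "y = (c, d)" by fastforce
  with assms have "\<bar>a - c\<bar> + \<bar>b - d\<bar> = 1" by (simp add: adj_def)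
  then have "(c = a + 1 \<and> d = b) \<or> (a = c + 1 \<and> d = b) \<or> (c = a \<and> d = b + 1) \<or> (c = a \<and> b = d + 1)"
    by (smt (verit))
  then show ?thesis using xy that by (elim disjE conjE) simp_all
qed

lemma reach_step: "adj x y \<Longrightarrow> x \<in> A \<Longrightarrow> y \<in> A \<Longrightarrow> reach A y z \<Longrightarrow> reach A x z"
  unfolding reach_def by (blast intro: converse_rtranclp_into_rtranclp)

lemma reach_refl: "reach A x x"
  by (simp add: reach_def)

lemma reach_trans: "reach A x y \<Longrightarrow> reach A y z \<Longrightarrow> reach A x z"
  unfolding reach_def by (rule rtranclp_trans)

lemma reach_sym: "reach A x y \<Longrightarrow> reach A y x"
  unfolding reach_def
proof (induction rule: rtranclp_induct)
  case (step y z)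
  then have "adj z y \<and> z \<in> A \<and> y \<in> A" using adj_sym by blast
  then show ?case using step.IH by (blast intro: converse_rtranclp_into_rtranclp)
qed simp

lemma reach_invariant:
  assumes "reach A x y" "\<And>x y. adj x y \<Longrightarrow> x \<in> A \<Longrightarrow> y \<in> A \<Longrightarrow> X x = X y"
  shows "X x = X y"
  using assms(1) unfolding reach_def by (induction rule: rtranclp_induct) (auto dest: assms(2))

lemma reach_vertical:
  assumes "\<And>k. 0 \<le> k \<Longrightarrow> k \<le> int n \<Longrightarrow> (a, k) \<in> A"
  shows "reach A (a, 0) (a, int n)"
  using assms
proof (induction n)
  case (Suc n)
  have "reach A (a, int n) (a, int (Suc n))"
    using Suc.prems by (intro reach_step[OF _ _ _ reach_refl]) (auto simp: adj_def)
  with Suc show ?case by (auto intro: reach_trans)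
qed (simp add: reach_refl)

lemma reach_horizontal:
  assumes "\<And>k. 0 \<le> k \<Longrightarrow> k \<le> int n \<Longrightarrow> (k, b) \<in> A"
  shows "reach A (int n, b) (0, b)"
  using assms
proof (induction n)
  case (Suc n)
  have "reach A (int (Suc n), b) (int n, b)"
    using Suc.prems by (intro reach_step[OF _ _ _ reach_refl]) (auto simp: adj_def)
  with Suc show ?case by (auto intro: reach_trans)
qed (simp add: reach_refl)

lemma outer_region_step: "adj x y \<Longrightarrow> y \<in> outer_region K p \<Longrightarrow> x \<notin> K \<Longrightarrow> x \<in> outer_region K p"
  using reach_step[of x y "- K" p] by (simp add: outer_region_def)

text \<open>
  The edges of the edge boundary of \<open>K\<close> whose inner vertex lies in \<open>E\<close> meet every unit square in
  an even number of edges, so they form the edge boundary of a set \<open>X\<close>; since \<open>K\<close> and the outside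
  are connected, \<open>X\<close> separates them as soon as one such edge leads to the outside.
\<close>

lemma outer_rim_subset:
  assumes far: "\<And>x y. x \<in> rim K \<Longrightarrow> y \<in> rim E \<Longrightarrow> x \<noteq> y \<and> \<not> adj x y"
    and conn: "\<And>x y. x \<in> K \<Longrightarrow> y \<in> K \<Longrightarrow> reach K x y"
    and start: "s \<in> K" "t \<in> outer_region K p" "adj s t" "s \<in> E"
    and edge: "a \<in> K" "b \<in> outer_region K p" "adj a b"
  shows "a \<in> E"
proof -
  \<comment> \<open>Neither \<open>x\<close>, a rim vertex of \<open>K\<close>, nor its neighbour
    \<open>z\<close> lies on the rim of \<open>E\<close>, so the edge between them cannot cross the
    boundary of \<open>E\<close>.\<close>
  have F: "(z \<in> E) = (x \<in> E)" if "x \<in> K" "adj x y" "y \<notin> K" "adj x z" for x y z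
  proof -
    have "x \<in> rim K" using that unfolding rim_def by blast
    then have "x \<notin> rim E" "z \<notin> rim E" using far that(4) by blast+
    then show ?thesis using that(4) adj_sym[OF that(4)] unfolding rim_def by blast
  qed
  define T where "T = (\<lambda>x y. (x \<in> K \<and> y \<notin> K \<and> x \<in> E) \<or> (y \<in> K \<and> x \<notin> K \<and> y \<in> E))"
  have "\<exists>X :: int \<Rightarrow> int \<Rightarrow> bool. \<forall>a b. T (a, b) (a + 1, b) = (X a b \<noteq> X (a + 1) b) \<and>
      T (a, b) (a, b + 1) = (X a b \<noteq> X a (b + 1))"
  proof (rule planar_bool_potential)
    fix a b :: int
    define w x y z where wxyz: "w = (a, b)" "x = (a + 1, b)" "y = (a + 1, b + 1)" "z = (a, b + 1)"
    have adj: "adj w x" "adj x w" "adj x y" "adj y x" "adj y z" "adj z y" "adj z w" "adj w z"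
      by (simp_all add: wxyz adj_def)
    \<comment> \<open>A square contains an even number of boundary edges of \<open>K\<close>, and by
      \<open>F\<close> their inner vertices are either all in \<open>E\<close> or all outside
      it.\<close>
    have "(T w x \<noteq> T x y) = (T w z \<noteq> T z y)"
      unfolding T_def
      using F[of w x z] F[of w z x] F[of w x x] F[of w z z]
        F[of x w y] F[of x y w] F[of x w w] F[of x y y]
        F[of y z x] F[of y x z] F[of y x x] F[of y z z]
        F[of z y w] F[of z w y] F[of z w w] F[of z y y] adj
      by argo
    then show "(T (a, b) (a + 1, b) \<noteq> T (a + 1, b) (a + 1, b + 1)) =
        (T (a, b) (a, b + 1) \<noteq> T (a, b + 1) (a + 1, b + 1))"
      by (simp add: wxyz)
  qed
  then obtain X :: "int \<Rightarrow> int \<Rightarrow> bool" where "\<forall>a b. T (a, b) (a + 1, b) = (X a b \<noteq> X (a + 1) b) \<and>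
      T (a, b) (a, b + 1) = (X a b \<noteq> X a (b + 1))" ..
  then have X: "T (a, b) (a + 1, b) = (X a b \<noteq> X (a + 1) b)"
    "T (a, b) (a, b + 1) = (X a b \<noteq> X a (b + 1))" for a b
    by simp_all
  define Z where "Z = (\<lambda>(a, b). X a b)"
  have T_sym: "T x y = T y x" for x y by (auto simp: T_def)
  have Z: "T x y = (Z x \<noteq> Z y)" if "adj x y" for x y
    using that
  proof (cases rule: adj_cases)
    case (2 a b)
    then show ?thesis using X(1)[of a b] T_sym[of x y] by (auto simp: Z_def)
  next
    case (4 a b)
    then show ?thesis using X(2)[of a b] T_sym[of x y] by (auto simp: Z_def)
  qed (simp_all add: Z_def X)
  \<comment> \<open>No edge inside \<open>K\<close> or inside its complement satisfies
    \<open>T\<close>. Thus \<open>Z\<close> is constant on the outer region and on \<open>K\<close>,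
    and the edge from \<open>s\<close> to \<open>t\<close> shows that the two constants
    differ.\<close>
  have Z_out: "Z v = Z p" if "v \<in> outer_region K p" for v
  proof (rule reach_invariant[of "- K"])
    show "reach (- K) v p" using that by (simp add: outer_region_def)
    show "Z x = Z y" if "adj x y" "x \<in> - K" "y \<in> - K" for x y
      using Z[OF that(1)] that(2,3) by (simp add: T_def)
  qed
  have "Z a = Z s"
  proof (rule reach_invariant[OF conn[OF edge(1) start(1)]])
    show "Z x = Z y" if "adj x y" "x \<in> K" "y \<in> K" for x y
      using Z[OF that(1)] that(2,3) by (simp add: T_def)
  qed
  moreover have "Z b = Z p" "Z t = Z p"
    using Z_out edge(2) start(2) by blast+
  moreover have "Z s \<noteq> Z t"
    using Z[OF start(3)] start by (auto simp: T_def outer_region_def)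
  ultimately have "T a b" using Z[OF edge(3)] by blast
  then show ?thesis using edge by (auto simp: T_def outer_region_def)
qed

text \<open>In terms of fillings, that of \<open>K\<close> is contained in that of \<open>E\<close>.
  A walk that avoids \<open>E\<close>, followed from \<open>p\<close>, could leave the outer region
  of \<open>K\<close> only by stepping onto a vertex of \<open>K\<close>, which would lie in
  \<open>E\<close> by \<open>outer_rim_subset\<close>.\<close>

lemma outer_region_antimono:
  assumes far: "\<And>x y. x \<in> rim K \<Longrightarrow> y \<in> rim E \<Longrightarrow> x \<noteq> y \<and> \<not> adj x y"
    and conn: "\<And>x y. x \<in> K \<Longrightarrow> y \<in> K \<Longrightarrow> reach K x y"
    and start: "s \<in> K" "t \<in> outer_region K p" "adj s t" "s \<in> E"
  shows "outer_region E p \<subseteq> outer_region K p"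
proof
  fix z assume z: "z \<in> outer_region E p"
  have "p \<notin> K"
    using start(2) reach_invariant[of "- K" t p "\<lambda>x. x \<in> K"] by (auto simp: outer_region_def)
  then have p: "p \<in> outer_region K p" by (simp add: outer_region_def reach_refl)
  have "reach (- E) z p" using z by (simp add: outer_region_def)
  then show "z \<in> outer_region K p"
    unfolding reach_def
  proof (induction rule: converse_rtranclp_induct)
    case (step x y)
    have "x \<notin> K"
    proof
      assume "x \<in> K"
      have "x \<in> E"
        by (rule outer_rim_subset[where b = y and s = s and t = t and p = p and K = K])
          (use far conn start step \<open>x \<in> K\<close> in auto)
      then show False using step by simp
    qed
    then show ?case using step outer_region_step by blast
  qed (rule p)
qed

text \<open>A piece whose outer region is minimal has a maximal filling. This filling cannot end
  inside the segment, since the piece of the next vertex would have a larger one. If the piece did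
  not reach past both ends of the segment, an end could escape to \<open>p\<close>.\<close>

lemma planar_cover:
  fixes K :: "nat \<Rightarrow> (int \<times> int) set"
  assumes mem: "\<And>i. i \<le> L \<Longrightarrow> (int i, 0) \<in> K i"
    and fin: "\<And>i. i \<le> L \<Longrightarrow> finite (K i)"
    and conn: "\<And>i x y. i \<le> L \<Longrightarrow> x \<in> K i \<Longrightarrow> y \<in> K i \<Longrightarrow> reach (K i) x y"
    and far: "\<And>i j x y. i \<le> L \<Longrightarrow> j \<le> L \<Longrightarrow> K i \<noteq> K j \<Longrightarrow> x \<in> rim (K i) \<Longrightarrow> y \<in> rim (K j) \<Longrightarrow>
      x \<noteq> y \<and> \<not> adj x y"
  shows "\<exists>i\<le>L. (\<exists>x\<in>K i. fst x \<le> 0) \<and> (\<exists>x\<in>K i. fst x \<ge> int L)"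
proof -
  have "bdd_above (snd ` (\<Union>i\<le>L. K i))" using fin by (intro bdd_above_finite) auto
  then obtain M where M: "\<forall>z\<in>snd ` (\<Union>i\<le>L. K i). z \<le> M" unfolding bdd_above_def ..
  have N: "snd x < int (nat (M + 1))" if "x \<in> (\<Union>i\<le>L. K i)" for x
    using bspec[OF M imageI[OF that]] by linarith
  \<comment> \<open>Row \<open>N\<close> lies strictly above all pieces, so \<open>p\<close> is
    outside each of them.\<close>
  define N where "N = nat (M + 1)"
  note N = N[folded N_def]
  define p where "p = (0 :: int, int N)"
  obtain O' where "O' \<in> (\<lambda>i. outer_region (K i) p) ` {..L}"
      and O': "\<And>A. A \<in> (\<lambda>i. outer_region (K i) p) ` {..L} \<Longrightarrow> A \<subseteq> O' \<Longrightarrow> O' = A"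
    using finite_has_minimal[of "(\<lambda>i. outer_region (K i) p) ` {..L}"] by auto
  then obtain i where "i \<le> L" "O' = outer_region (K i) p" by auto
  with O' have i: "i \<le> L" "\<And>j. j \<le> L \<Longrightarrow> outer_region (K j) p \<subseteq> outer_region (K i) p \<Longrightarrow>
      outer_region (K j) p = outer_region (K i) p"
    by auto
  have rec: "(int m', 0) \<notin> outer_region (K i) p"
    if m: "m \<le> L" "m' \<le> L" "\<bar>int m - int m'\<bar> = 1" "(int m, 0) \<notin> outer_region (K i) p" for m m'
  proof
    assume out: "(int m', 0) \<in> outer_region (K i) p"
    let ?x = "(int m, 0 :: int)" and ?y = "(int m', 0 :: int)"
    have a: "adj ?x ?y" using m(3) by (simp add: adj_def)
    have x: "?x \<in> K i" using outer_region_step[OF a out] m(4) by blast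
    have y: "?y \<in> K m'" "?y \<notin> K i" using mem m(2) out by (auto simp: outer_region_def)
    then have ne: "K i \<noteq> K m'" by blast
    \<comment> \<open>Otherwise \<open>?x\<close> and \<open>?y\<close> would be adjacent rim
      vertices of two different pieces.\<close>
    have xE: "?x \<in> K m'"
    proof (rule ccontr)
      assume nx: "?x \<notin> K m'"
      then have "?y \<in> rim (K m')" "?x \<in> rim (K i)" using x y a adj_sym[OF a] by (auto simp: rim_def)
      with far[OF i(1) m(2) ne] a show False by blast
    qed
    have sub: "outer_region (K m') p \<subseteq> outer_region (K i) p"
    proof (rule outer_region_antimono[where s = ?x and t = ?y])
      show "x \<noteq> y \<and> \<not> adj x y" if "x \<in> rim (K i)" "y \<in> rim (K m')" for x y
        using far i(1) m(2) ne that .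
      show "reach (K i) x y" if "x \<in> K i" "y \<in> K i" for x y
        using conn i(1) that .
    qed (fact x out a xE)+
    \<comment> \<open>Minimality turns the inclusion into an equality, yet \<open>?y\<close> is in
      the outer region of \<open>K i\<close> and in \<open>K m'\<close> itself.\<close>
    from i(2)[OF m(2) sub] out y show False by (auto simp: outer_region_def)
  qed
  have start: "(int i, 0) \<notin> outer_region (K i) p" using mem i by (auto simp: outer_region_def)
  have up: "(int j, 0) \<notin> outer_region (K i) p" if "i \<le> j" "j \<le> L" for j
    using that
  proof (induction j rule: dec_induct)
    case (step n)
    then show ?case using rec[of n "Suc n"] by auto
  qed (rule start)
  have down: "(int j, 0) \<notin> outer_region (K i) p" if "j \<le> i" for j
    using that
  proof (induction j rule: inc_induct)
    case (step n)
    then show ?case using rec[of "Suc n" n] i(1) by auto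
  qed (rule start)
  have inside: "(int j, 0) \<notin> outer_region (K i) p" if "j \<le> L" for j
    using up down that by (cases "i \<le> j") auto
  have high: "(a, int N) \<notin> K i" for a
    using N[of "(a, int N)"] i(1) by auto
  have "\<exists>x\<in>K i. fst x \<le> 0"
  proof (rule ccontr)
    assume none: "\<not> ?thesis"
    then have "reach (- K i) (0, 0) p" unfolding p_def by (intro reach_vertical) force
    then show False using inside[of 0] none by (force simp: outer_region_def)
  qed
  moreover have "\<exists>x\<in>K i. fst x \<ge> int L"
  proof (rule ccontr)
    assume none: "\<not> ?thesis"
    \<comment> \<open>The escape route goes up column \<open>L\<close> to row \<open>N\<close> and
      then along that row to \<open>p\<close>.\<close>
    then have "reach (- K i) (int L, 0) (int L, int N)" by (intro reach_vertical) force
    moreover have "reach (- K i) (int L, int N) p"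
      unfolding p_def using high by (intro reach_horizontal) force
    ultimately have "reach (- K i) (int L, 0) p" by (rule reach_trans)
    then show False using inside[of L] none by (force simp: outer_region_def)
  qed
  ultimately show ?thesis using i(1) by blast
qed

section \<open>Distances, translations and boundaries in the grid\<close>

lemma grid_dist_le_1:
  assumes "x = y \<or> (x, y) \<in> grid_edges d"
  shows "grid_dist d x y \<le> 1"
proof (cases "x = y")
  case True
  then have "grid_dist d x y \<le> 0" unfolding grid_dist_def by (intro Least_le) simp
  then show ?thesis by simp
next
  case False
  then have "(x, y) \<in> grid_edges d ^^ 1" using assms by simp
  then show ?thesis unfolding grid_dist_def by (rule Least_le)
qed

lemma generator_in_grid: "i < d \<Longrightarrow> generator i \<in> grid d"
  by (auto simp: grid_def generator_def)

lemma grid_add: "x \<in> grid d \<Longrightarrow> y \<in> grid d \<Longrightarrow> x + y \<in> grid d"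
  by (simp add: grid_def)

lemma grid_diff: "x \<in> grid d \<Longrightarrow> y \<in> grid d \<Longrightarrow> x - y \<in> grid d"
  by (simp add: grid_def)

text \<open>Moving a nonzero coordinate towards 0 lowers the l1 norm. The point is that the
  \<open>LEAST\<close> in \<open>grid_dist d 0 x\<close> is then the length of an actual
  walk.\<close>

lemma grid_reachable: "x \<in> grid d \<Longrightarrow> (0, x) \<in> (grid_edges d)\<^sup>*"
proof (induction "\<Sum>i<d. nat \<bar>x i\<bar>" arbitrary: x rule: less_induct)
  case less
  show ?case
  proof (cases "x = 0")
    case False
    then obtain i where i: "x i \<noteq> 0" by fastforce
    then have "i < d" using less.prems by (auto simp: grid_def not_le[symmetric])
    define y where "y = (if x i > 0 then x - generator i else x + generator i)"
    have y: "y \<in> grid d"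
      using less.prems generator_in_grid[OF \<open>i < d\<close>] by (simp add: y_def grid_add grid_diff)
    have "(\<Sum>j<d. nat \<bar>y j\<bar>) < (\<Sum>j<d. nat \<bar>x j\<bar>)"
    proof (rule sum_strict_mono_ex1)
      show "\<forall>j\<in>{..<d}. nat \<bar>y j\<bar> \<le> nat \<bar>x j\<bar>"
        using i by (auto simp: y_def generator_def)
      show "\<exists>j\<in>{..<d}. nat \<bar>y j\<bar> < nat \<bar>x j\<bar>"
        using i \<open>i < d\<close> by (intro bexI[of _ i]) (auto simp: y_def generator_def)
    qed simp
    moreover have "(y, x) \<in> grid_edges d"
      using y less.prems \<open>i < d\<close> by (auto simp: grid_edges_def y_def)
    ultimately show ?thesis using less.hyps[OF _ y] by (blast intro: rtrancl_into_rtrancl)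
  qed simp
qed

lemma relpow_grid_edges_coordinate:
  "(x, y) \<in> grid_edges d ^^ n \<Longrightarrow> \<bar>x i - y i\<bar> \<le> int n"
proof (induction n arbitrary: y)
  case (Suc n)
  then obtain z where "(x, z) \<in> grid_edges d ^^ n" and z: "(z, y) \<in> grid_edges d" by auto
  then have "\<bar>x i - z i\<bar> \<le> int n" using Suc by blast
  moreover have "\<bar>z i - y i\<bar> \<le> 1" using z by (auto simp: grid_edges_def generator_def)
  ultimately show ?case by simp
qed simp

lemma grid_ball_coordinate:
  assumes "v \<in> grid_ball d 0 r"
  shows "\<bar>v i\<bar> \<le> int r"
proof -
  have v: "v \<in> grid d" "grid_dist d 0 v \<le> r" using assms by (auto simp: grid_ball_def)
  have "\<exists>n. (0, v) \<in> grid_edges d ^^ n"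
    using grid_reachable[OF v(1)] by (simp add: rtrancl_power)
  then have "(0, v) \<in> grid_edges d ^^ grid_dist d 0 v"
    unfolding grid_dist_def by (rule LeastI_ex)
  from relpow_grid_edges_coordinate[OF this, of i] v(2) show ?thesis by simp
qed

lemma grid_ball_mono: "r' \<le> r \<Longrightarrow> grid_ball d u r' \<subseteq> grid_ball d u r"
  by (auto simp: grid_ball_def)

lemma countable_grid: "countable (grid d)"
proof (rule countable_image_inj_on)
  show "countable ((\<lambda>x. map x [0..<d]) ` grid d)" by (rule countableI_type)
  show "inj_on (\<lambda>x. map x [0..<d]) (grid d)"
  proof (rule inj_onI, rule ext)
    fix x y i assume "x \<in> grid d" "y \<in> grid d" "map x [0..<d] = map y [0..<d]"
    then show "x i = y i" by (cases "i < d") (auto simp: grid_def map_eq_conv)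
  qed
qed

lemma grid_edges_translate:
  assumes "u \<in> grid d" "(x, y) \<in> grid_edges d"
  shows "(u + x, u + y) \<in> grid_edges d"
  using assms grid_add[OF assms(1)] by (auto simp: grid_edges_def add.assoc)

lemma grid_boundary_translate:
  assumes "u \<in> grid d" "a \<in> grid_boundary d F"
  shows "u + a \<in> grid_boundary d ((+) u ` F)"
  using assms grid_edges_translate[OF assms(1)] by (fastforce simp: grid_boundary_def)

text \<open>The translation raises the maximum of coordinate 0.\<close>

lemma finite_translate_neq:
  fixes w :: vertex
  assumes "finite F" "F \<noteq> {}" "w 0 > 0"
  shows "(+) w ` F \<noteq> F"
proof
  assume eq: "(+) w ` F = F"
  let ?M = "Max ((\<lambda>x. x 0) ` F)"
  have "?M \<in> (\<lambda>x. x 0) ` F" using assms by (intro Max_in) auto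
  then obtain x where x: "x \<in> F" "x 0 = ?M" by auto
  then have "w + x \<in> F" using eq by blast
  then have "(w + x) 0 \<le> ?M" using assms by (intro Max_ge finite_imageI imageI)
  with x assms show False by simp
qed

text \<open>Points of \<open>D\<close> with extreme coordinate 0 are boundary points, because a
  further step along \<open>generator 0\<close> leaves \<open>D\<close>.\<close>

lemma grid_boundary_extremes:
  assumes "finite D" "D \<subseteq> grid d" "x \<in> D" "d > 0"
  obtains a b where "a \<in> grid_boundary d D" "b \<in> grid_boundary d D" "a 0 \<ge> x 0" "b 0 \<le> x 0"
proof -
  let ?I = "(\<lambda>x. x 0) ` D"
  have fin: "finite ?I" "?I \<noteq> {}" using assms by auto
  obtain a where a: "a \<in> D" "a 0 = Max ?I" using Max_in[OF fin] by auto
  obtain b where b: "b \<in> D" "b 0 = Min ?I" using Min_in[OF fin] by auto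
  have g: "generator 0 \<in> grid d" using assms by (simp add: generator_in_grid)
  have "a + generator 0 \<notin> D"
  proof
    assume "a + generator 0 \<in> D"
    then have "(a + generator 0) 0 \<le> Max ?I" using fin by (intro Max_ge imageI)
    then show False using a by (simp add: generator_def)
  qed
  moreover have "(a, a + generator 0) \<in> grid_edges d"
    using a assms grid_add[OF _ g] by (auto simp: grid_edges_def)
  ultimately have "a \<in> grid_boundary d D" using a by (auto simp: grid_boundary_def)
  moreover have "b - generator 0 \<notin> D"
  proof
    assume "b - generator 0 \<in> D"
    then have "Min ?I \<le> (b - generator 0) 0" using fin by (intro Min_le imageI)
    then show False using b by (simp add: generator_def)
  qed
  then have "b \<in> grid_boundary d D"
    using b assms grid_diff[OF _ g] by (force simp: grid_boundary_def grid_edges_def)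
  moreover have "a 0 \<ge> x 0" "b 0 \<le> x 0" using fin a b assms(3) by auto
  ultimately show ?thesis using that by blast
qed

section \<open>Planar slices of toast pieces\<close>

definition axis_vertex :: "int \<Rightarrow> vertex" where
  "axis_vertex a = (\<lambda>j. if j = 0 then a else 0)"

definition plane :: "int \<times> int \<Rightarrow> vertex" where
  "plane z = (\<lambda>j. if j = 0 then fst z else if j = 1 then snd z else 0)"

lemma plane_adj:
  assumes "d > 1" "adj x y"
  shows "(plane x, plane y) \<in> grid_edges d"
proof -
  have g: "plane z \<in> grid d" for z using assms(1) by (simp add: plane_def grid_def)
  have step: "(plane (a, b), plane (a + 1, b)) \<in> grid_edges d" "(plane (a + 1, b), plane (a, b)) \<in> grid_edges d"
    "(plane (a, b), plane (a, b + 1)) \<in> grid_edges d" "(plane (a, b + 1), plane (a, b)) \<in> grid_edges d" for a b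
  proof -
    have "plane (a + 1, b) = plane (a, b) + generator 0"
         "plane (a, b + 1) = plane (a, b) + generator 1"
      by (auto simp: plane_def generator_def)
    moreover have "0 < d" using assms(1) by simp
    ultimately show "(plane (a, b), plane (a + 1, b)) \<in> grid_edges d"
        "(plane (a + 1, b), plane (a, b)) \<in> grid_edges d"
        "(plane (a, b), plane (a, b + 1)) \<in> grid_edges d"
        "(plane (a, b + 1), plane (a, b)) \<in> grid_edges d"
      using assms(1) g[of "(a, b)"] g[of "(a + 1, b)"] g[of "(a, b + 1)"]
      unfolding grid_edges_def by blast+
  qed
  from assms(2) show ?thesis by (cases rule: adj_cases) (simp_all add: step)
qed

lemma reach_component: "reach A x y \<Longrightarrow> reach {z. reach A x z} x y"
  unfolding reach_def
proof (induction rule: rtranclp_induct)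
  case (step y z)
  then have "(\<lambda>x y. adj x y \<and> x \<in> A \<and> y \<in> A)\<^sup>*\<^sup>* x z" by (auto intro: rtranclp.rtrancl_into_rtrancl)
  then show ?case using step by (intro rtranclp.rtrancl_into_rtrancl[OF step.IH]) auto
qed simp

lemma reach_subset: "reach A x y \<Longrightarrow> x \<in> A \<Longrightarrow> y \<in> A"
  using reach_invariant[of A x y "\<lambda>x. x \<in> A"] by simp

text \<open>The pieces are cut with the plane of the first two coordinates,
  \<open>planar_cover\<close> is applied to the slices, and the width found there is carried to
  boundary points of the whole piece.\<close>

lemma toast_wide_piece:
  assumes d: "d > 1" and q: "q \<ge> 1" and toast: "toast d q \<D>"
    and D: "\<And>i. i \<le> L \<Longrightarrow> D i \<in> \<D>" "\<And>i. i \<le> L \<Longrightarrow> axis_vertex (int i) \<in> D i"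
  shows "\<exists>i\<le>L. \<exists>a\<in>grid_boundary d (D i). \<exists>b\<in>grid_boundary d (D i). a 0 - b 0 \<ge> int L"
proof -
  define A where "A i = plane -` D i" for i
  \<comment> \<open>A connected piece may have a disconnected slice, so only the component of the
    axis vertex is kept. Its rim still consists of boundary points of \<open>D i\<close>.\<close>
  define K where "K i = {z. reach (A i) (int i, 0) z}" for i :: nat
  have piece: "finite (D i)" "D i \<subseteq> grid d" if "i \<le> L" for i
    using toast D(1)[OF that] by (auto simp: toast_def)
  have inj: "inj plane"
  proof (rule injI)
    fix x y assume "plane x = plane y"
    from fun_cong[OF this, of 0] fun_cong[OF this, of 1] show "x = y"
      by (simp add: plane_def prod_eq_iff)
  qed
  have axis_vertex: "axis_vertex a = plane (a, 0)" for a by (auto simp: axis_vertex_def plane_def)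
  have base: "(int i, 0) \<in> A i" if "i \<le> L" for i
    using D(2)[OF that] by (simp add: A_def axis_vertex)
  have KA: "K i \<subseteq> A i" if "i \<le> L" for i
    using reach_subset base[OF that] by (auto simp: K_def)
  have rim: "plane x \<in> grid_boundary d (D i)" if "i \<le> L" "x \<in> rim (K i)" for i x
  proof -
    obtain y where y: "x \<in> K i" "adj x y" "y \<notin> K i" using \<open>x \<in> rim (K i)\<close> unfolding rim_def by blast
    have x: "x \<in> A i" using KA that(1) y(1) by blast
    have "y \<notin> A i"
    proof
      assume "y \<in> A i"
      then have "reach (A i) x y" using y(2) x by (intro reach_step[OF _ _ _ reach_refl])
      then show False using y by (auto simp: K_def intro: reach_trans)
    qed
    then show ?thesis using x plane_adj[OF d y(2)] by (auto simp: grid_boundary_def A_def)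
  qed
  have "\<exists>i\<le>L. (\<exists>x\<in>K i. fst x \<le> 0) \<and> (\<exists>x\<in>K i. fst x \<ge> int L)"
  proof (rule planar_cover)
    fix i assume i: "i \<le> L"
    show "(int i, 0) \<in> K i" by (simp add: K_def reach_refl)
    have "finite (A i)" unfolding A_def using piece[OF i] inj by (intro finite_vimageI)
    then show "finite (K i)" using KA[OF i] finite_subset by blast
    fix x y assume "x \<in> K i" "y \<in> K i"
    then have "reach (K i) (int i, 0) x" "reach (K i) (int i, 0) y"
      using reach_component by (auto simp: K_def)
    then show "reach (K i) x y" using reach_sym reach_trans by blast
  next
    fix i j x y
    assume i: "i \<le> L" "j \<le> L" "K i \<noteq> K j" "x \<in> rim (K i)" "y \<in> rim (K j)"
    show "x \<noteq> y \<and> \<not> adj x y"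
    proof (rule ccontr)
      assume near: "\<not> ?thesis"
      \<comment> \<open>Equal or adjacent rim points have distance at most 1, hence at most
        \<open>q\<close>, which forces equal pieces; the two components of the common slice then
        touch and coincide.\<close>
      then have "grid_dist d (plane x) (plane y) \<le> q"
        using grid_dist_le_1[of "plane x" "plane y" d] plane_adj[OF d, of x y] q by fastforce
      then have "D i = D j"
        using toast rim[OF i(1) i(4)] rim[OF i(2) i(5)] D(1)[OF i(1)] D(1)[OF i(2)]
        unfolding toast_def by blast
      then have A: "A i = A j" by (simp add: A_def)
      have x: "x \<in> K i" and y: "y \<in> K j" using i unfolding rim_def by blast+
      then have "x \<in> A i" "y \<in> A i" using KA i A by blast+
      then have "reach (A i) x y"
        using near reach_refl reach_step[OF _ _ _ reach_refl, of x y "A i"] by blast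
      then have "reach (A i) (int i, 0) (int j, 0)"
        using x y reach_trans reach_sym unfolding K_def A[symmetric] mem_Collect_eq by blast
      then have "K i = K j"
        using reach_trans reach_sym unfolding K_def A[symmetric] by blast
      with i(3) show False by simp
    qed
  qed
  then obtain i x y where i: "i \<le> L" and xy: "x \<in> K i" "fst x \<le> 0" "y \<in> K i" "fst y \<ge> int L" by blast
  have "plane x \<in> D i" "plane y \<in> D i" using xy KA[OF i] by (auto simp: A_def)
  moreover have "d > 0" using d by simp
  ultimately obtain a b where "a \<in> grid_boundary d (D i)" "a 0 \<ge> plane y 0"
      "b \<in> grid_boundary d (D i)" "b 0 \<le> plane x 0"
    using grid_boundary_extremes piece[OF i] by metis
  then show ?thesis using i xy
    by (intro exI[of _ i] conjI bexI[of _ a] bexI[of _ b]) (auto simp: plane_def)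
qed

section \<open>Laws and independence of labelled balls\<close>

lemma prob_space_uniform_01: "prob_space (uniform_measure lborel {0..1::real})"
  by (rule prob_space_uniform_measure) simp_all

lemma prob_space_labelling: "prob_space (labelling V)"
  unfolding labelling_def by (intro prob_space_PiM prob_space_uniform_01)

text \<open>Translation invariance: \<open>x \<mapsto> u + x\<close> is injective, and reindexing a
  product of equal factors along an injection gives a product again.\<close>

lemma distr_labelled_ball:
  assumes "u \<in> grid d"
  shows "distr (labelling (grid d)) (labelling (grid_ball d 0 r)) (\<lambda>\<omega>. labelled_ball d \<omega> u r) =
    labelling (grid_ball d 0 r)"
  unfolding labelling_def labelled_ball_def
proof (rule distr_PiM_reindex)
  show "(\<lambda>x. u + x) \<in> grid_ball d 0 r \<rightarrow> grid d"
    using grid_add[OF assms] by (auto simp: grid_ball_def)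
qed (simp_all add: prob_space_uniform_01)

lemma measurable_labelled_ball:
  assumes "u \<in> grid d"
  shows "(\<lambda>\<omega>. labelled_ball d \<omega> u r) \<in> labelling (grid d) \<rightarrow>\<^sub>M labelling (grid_ball d 0 r)"
  unfolding labelling_def labelled_ball_def
  using grid_add[OF assms]
  by (intro measurable_restrict measurable_component_singleton) (auto simp: grid_ball_def)

lemma sets_labelled_ball:
  assumes "u \<in> grid d" "T \<in> sets (labelling (grid_ball d 0 r))"
  shows "{\<omega> \<in> space (labelling (grid d)). labelled_ball d \<omega> u r \<in> T} \<in> sets (labelling (grid d))"
  using measurable_sets[OF measurable_labelled_ball[OF assms(1)] assms(2)]
  by (simp add: vimage_def Int_def conj_commute)

lemma prob_labelled_ball:
  assumes "u \<in> grid d" "T \<in> sets (labelling (grid_ball d 0 r))"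
  shows "\<P>(\<omega> in labelling (grid d). labelled_ball d \<omega> u r \<in> T) = measure (labelling (grid_ball d 0 r)) T"
proof -
  have "measure (labelling (grid_ball d 0 r)) T =
      measure (distr (labelling (grid d)) (labelling (grid_ball d 0 r)) (\<lambda>\<omega>. labelled_ball d \<omega> u r)) T"
    by (simp add: distr_labelled_ball[OF assms(1)])
  also have "\<dots> = measure (labelling (grid d)) ((\<lambda>\<omega>. labelled_ball d \<omega> u r) -` T \<inter> space (labelling (grid d)))"
    by (rule measure_distr[OF measurable_labelled_ball[OF assms(1)] assms(2)])
  finally show ?thesis by (simp add: vimage_def Int_def conj_commute)
qed

lemma indep_vars_labels:
  "prob_space.indep_vars (labelling (grid d)) (\<lambda>_. uniform_measure lborel {0..1}) (\<lambda>v \<omega>. \<omega> v) (grid d)"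
proof -
  interpret prob_space "labelling (grid d)" by (rule prob_space_labelling)
  let ?U = "\<lambda>_::vertex. uniform_measure lborel {0..1::real}"
  \<comment> \<open>Independence is checked by comparing the joint law, here that of the identity,
    with the product of its marginals.\<close>
  have "distr (labelling (grid d)) (\<Pi>\<^sub>M v\<in>grid d. ?U v) (\<lambda>\<omega>. \<lambda>v\<in>grid d. \<omega> v) = (\<Pi>\<^sub>M v\<in>grid d. ?U v)"
    unfolding labelling_def using distr_PiM_reindex[of "grid d" ?U id "grid d"]
    by (simp add: prob_space_uniform_01)
  also have "\<dots> = (\<Pi>\<^sub>M v\<in>grid d. distr (labelling (grid d)) (?U v) (\<lambda>\<omega>. \<omega> v))"
    unfolding labelling_def
    by (intro PiM_cong refl distr_PiM_component[symmetric] prob_space_uniform_01)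
  finally show ?thesis
  proof (subst indep_vars_iff_distr_eq_PiM')
    show "grid d \<noteq> {}" by (auto simp: grid_def)
    show "random_variable (uniform_measure lborel {0..1}) (\<lambda>\<omega>. \<omega> v)" if "v \<in> grid d" for v
      unfolding labelling_def using that by (rule measurable_component_singleton)
  qed
qed

text \<open>The gap in coordinate \<open>i\<close> makes the two balls disjoint, and each labelled
  ball is a function of the labels in its own ball.\<close>

lemma indep_var_labelled_ball:
  assumes u: "u \<in> grid d" "v \<in> grid d" and far: "\<bar>u i - v i\<bar> > 2 * int r"
  shows "prob_space.indep_var (labelling (grid d))
    (labelling (grid_ball d 0 r)) (\<lambda>\<omega>. labelled_ball d \<omega> u r)
    (labelling (grid_ball d 0 r)) (\<lambda>\<omega>. labelled_ball d \<omega> v r)"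
proof -
  interpret prob_space "labelling (grid d)" by (rule prob_space_labelling)
  let ?B = "grid_ball d 0 r"
  let ?A = "\<lambda>u. (+) u ` ?B"
  let ?Y = "\<lambda>u \<eta>. \<lambda>x\<in>?B. \<eta> (u + x)"
  have sub: "?A u \<subseteq> grid d" "?A v \<subseteq> grid d"
    using grid_add u by (auto simp: grid_ball_def)
  have "?A u \<inter> ?A v = {}"
  proof (rule ccontr)
    assume "?A u \<inter> ?A v \<noteq> {}"
    then obtain x y where xy: "x \<in> ?B" "y \<in> ?B" "u + x = v + y" by auto
    have "u i + x i = v i + y i" using fun_cong[OF xy(3), of i] by simp
    then show False
      using far grid_ball_coordinate[OF xy(1), of i] grid_ball_coordinate[OF xy(2), of i] by linarith
  qed
  then have ind: "indep_var (labelling (?A u)) (\<lambda>\<omega>. restrict \<omega> (?A u))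
      (labelling (?A v)) (\<lambda>\<omega>. restrict \<omega> (?A v))"
    using indep_var_restrict[OF indep_vars_labels _ sub] by (simp add: labelling_def)
  have meas: "?Y u \<in> labelling (?A u) \<rightarrow>\<^sub>M labelling ?B" for u
    unfolding labelling_def by (intro measurable_restrict measurable_component_singleton) auto
  have eq: "?Y u \<circ> (\<lambda>\<omega>. restrict \<omega> (?A u)) = (\<lambda>\<omega>. labelled_ball d \<omega> u r)" for u
    by (auto simp: fun_eq_iff labelled_ball_def)
  show ?thesis using indep_var_compose[OF ind meas meas] unfolding eq .
qed

section \<open>Stopping events\<close>

lemma labelled_ball_restrict:
  assumes "r' \<le> r"
  shows "restrict (labelled_ball d \<omega> u r) (grid_ball d 0 r') = labelled_ball d \<omega> u r'"
  using grid_ball_mono[OF assms] by (auto simp: labelled_ball_def fun_eq_iff)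

lemma measurable_restrict_ball:
  assumes "r' \<le> r"
  shows "(\<lambda>\<eta>. restrict \<eta> (grid_ball d 0 r')) \<in>
    labelling (grid_ball d 0 r) \<rightarrow>\<^sub>M labelling (grid_ball d 0 r')"
  unfolding labelling_def by (rule measurable_restrict_subset[OF grid_ball_mono[OF assms]])

lemma le_coding_radius_iff:
  "enat k \<le> coding_radius d S \<omega> u \<longleftrightarrow> (\<forall>r<k. labelled_ball d \<omega> u r \<notin> S r)"
  unfolding coding_radius_def by (auto simp: le_INF_iff not_less)

lemma coding_radius_stop:
  assumes "coding_radius d S \<omega> u = enat r"
  shows "labelled_ball d \<omega> u r \<in> S r"
proof -
  have "\<not> enat (Suc r) \<le> coding_radius d S \<omega> u" "enat r \<le> coding_radius d S \<omega> u"
    using assms by simp_all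
  then show ?thesis unfolding le_coding_radius_iff by (auto simp: less_Suc_eq)
qed

text \<open>The event that the coding radius is at least \<open>k\<close>, as a set of labelled
  balls around the origin, so that the laws above apply at any vertex. The ball of radius
  \<open>k\<close> itself is not tested.\<close>

definition not_stopped where
  "not_stopped d S k =
    {\<eta> \<in> space (labelling (grid_ball d 0 k)). \<forall>r<k. restrict \<eta> (grid_ball d 0 r) \<notin> S r}"

definition stops_with where
  "stops_with d S f r F = {\<eta> \<in> not_stopped d S r. \<eta> \<in> S r \<and> f r \<eta> = F}"

lemma labelled_ball_not_stopped:
  assumes "u \<in> grid d" "\<omega> \<in> space (labelling (grid d))"
  shows "labelled_ball d \<omega> u k \<in> not_stopped d S k \<longleftrightarrow> enat k \<le> coding_radius d S \<omega> u"
  using measurable_space[OF measurable_labelled_ball[OF assms(1)] assms(2)]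
  by (auto simp: not_stopped_def le_coding_radius_iff labelled_ball_restrict)

section \<open>Wide outputs and the tail of the coding radius\<close>

context
  fixes d S f
  assumes alg: "uniform_local_algorithm d (count_space {D. finite D \<and> D \<subseteq> grid d}) S f"
begin

lemma sets_not_stopped: "not_stopped d S k \<in> sets (labelling (grid_ball d 0 k))"
proof -
  have "{\<eta> \<in> space (labelling (grid_ball d 0 k)). restrict \<eta> (grid_ball d 0 r) \<in> S r}
      \<in> sets (labelling (grid_ball d 0 k))" if "r < k" for r
    using that alg measurable_sets[OF measurable_restrict_ball[of r k d], of "S r"]
    by (auto simp: uniform_local_algorithm_def vimage_def Int_def conj_commute)
  then have "space (labelling (grid_ball d 0 k)) -
      (\<Union>r<k. {\<eta> \<in> space (labelling (grid_ball d 0 k)). restrict \<eta> (grid_ball d 0 r) \<in> S r})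
      \<in> sets (labelling (grid_ball d 0 k))" by auto
  also have "space (labelling (grid_ball d 0 k)) -
      (\<Union>r<k. {\<eta> \<in> space (labelling (grid_ball d 0 k)). restrict \<eta> (grid_ball d 0 r) \<in> S r}) =
      not_stopped d S k" by (auto simp: not_stopped_def)
  finally show ?thesis .
qed

lemma sets_stops_with:
  assumes "finite F" "F \<subseteq> grid d"
  shows "stops_with d S f r F \<in> sets (labelling (grid_ball d 0 r))"
proof -
  let ?L = "labelling (grid_ball d 0 r)"
  have "f r \<in> ?L \<rightarrow>\<^sub>M count_space {D. finite D \<and> D \<subseteq> grid d}"
    using alg by (auto simp: uniform_local_algorithm_def)
  from measurable_sets[OF this, of "{F}"] assms
  have "{\<eta> \<in> space ?L. f r \<eta> \<in> {F}} \<in> sets ?L"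
    by (simp add: vimage_def Int_def conj_commute)
  moreover have "S r \<in> sets ?L" using alg by (auto simp: uniform_local_algorithm_def)
  moreover have "stops_with d S f r F = not_stopped d S r \<inter> (S r \<inter> {\<eta> \<in> space ?L. f r \<eta> \<in> {F}})"
    by (auto simp: stops_with_def not_stopped_def)
  ultimately show ?thesis using sets_not_stopped by auto
qed

lemma output_finite:
  assumes "u \<in> grid d" "\<omega> \<in> space (labelling (grid d))"
  shows "finite (f r (labelled_ball d \<omega> u r))" "f r (labelled_ball d \<omega> u r) \<subseteq> grid d"
proof -
  have "f r \<in> labelling (grid_ball d 0 r) \<rightarrow>\<^sub>M count_space {D. finite D \<and> D \<subseteq> grid d}"
    using alg by (auto simp: uniform_local_algorithm_def)
  from measurable_space[OF this measurable_space[OF measurable_labelled_ball[OF assms(1)] assms(2)]]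
  show "finite (f r (labelled_ball d \<omega> u r))" "f r (labelled_ball d \<omega> u r) \<subseteq> grid d" by auto
qed

text \<open>
  Translating \<open>F\<close> by the difference \<open>w\<close> of two of its boundary points makes the boundaries of
  \<open>F\<close> and its translate meet, while the outputs at \<open>0\<close> and \<open>w\<close> are independent.
\<close>

lemma wide_output_null:
  assumes toast: "constructs_toast d q S f"
    and F: "finite F" "F \<subseteq> grid d"
    and ab: "a \<in> grid_boundary d F" "b \<in> grid_boundary d F" "a 0 - b 0 > 2 * int r"
  shows "measure (labelling (grid_ball d 0 r)) (stops_with d S f r F) = 0"
proof (rule ccontr)
  interpret prob_space "labelling (grid d)" by (rule prob_space_labelling)
  let ?M = "labelling (grid d)" and ?N = "labelling (grid_ball d 0 r)" and ?T = "stops_with d S f r F"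
  assume pos: "measure ?N ?T \<noteq> 0"
  have T: "?T \<in> sets ?N" using F by (rule sets_stops_with)
  have ab_grid: "a \<in> grid d" "b \<in> grid d" using ab F by (auto simp: grid_boundary_def)
  define w where "w = a - b"
  have w: "w \<in> grid d" using ab_grid by (simp add: w_def grid_diff)
  have z: "0 \<in> grid d" by (simp add: grid_def)
  have "indep_var ?N (\<lambda>\<omega>. labelled_ball d \<omega> 0 r) ?N (\<lambda>\<omega>. labelled_ball d \<omega> w r)"
    by (rule indep_var_labelled_ball[OF z w, where i = 0]) (use ab(3) in \<open>simp add: w_def\<close>)
  \<comment> \<open>The joint probability is the square of the measure of \<open>?T\<close>.\<close>
  from prob_indep_random_variable[OF this T T]
  have "\<P>(\<omega> in ?M. labelled_ball d \<omega> 0 r \<in> ?T \<and> labelled_ball d \<omega> w r \<in> ?T) \<noteq> 0"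
    using pos by (simp add: prob_labelled_ball[OF _ T] z w)
  moreover have "{\<omega> \<in> space ?M. labelled_ball d \<omega> 0 r \<in> ?T \<and> labelled_ball d \<omega> w r \<in> ?T} \<in> sets ?M"
    by (intro sets.sets_Collect_conj sets_labelled_ball z w T)
  ultimately have "\<not> (AE \<omega> in ?M. \<not> (labelled_ball d \<omega> 0 r \<in> ?T \<and> labelled_ball d \<omega> w r \<in> ?T))"
    by (subst (asm) prob_eq_0) auto
  moreover have "AE \<omega> in ?M. \<not> (labelled_ball d \<omega> 0 r \<in> ?T \<and> labelled_ball d \<omega> w r \<in> ?T)"
    using toast[unfolded constructs_toast_def] AE_space
  proof eventually_elim
    case (elim \<omega>)
    then obtain \<D> where \<D>: "toast d q \<D>"
      and out: "\<And>u. u \<in> grid d \<Longrightarrow> \<exists>r. coding_radius d S \<omega> u = enat r \<and>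
         minimal_piece \<D> u ((+) u ` f r (labelled_ball d \<omega> u r))" by blast
    show ?case
    proof
      assume both: "labelled_ball d \<omega> 0 r \<in> ?T \<and> labelled_ball d \<omega> w r \<in> ?T"
      have piece: "(+) u ` F \<in> \<D>" if u: "u \<in> grid d" "labelled_ball d \<omega> u r \<in> ?T" for u
      proof -
        have st: "labelled_ball d \<omega> u r \<in> not_stopped d S r" "labelled_ball d \<omega> u r \<in> S r"
          "f r (labelled_ball d \<omega> u r) = F" using u(2) by (auto simp: stops_with_def)
        obtain r' where r': "coding_radius d S \<omega> u = enat r'"
          "minimal_piece \<D> u ((+) u ` f r' (labelled_ball d \<omega> u r'))" using out[OF u(1)] by blast
        have "r \<le> r'" using st(1) labelled_ball_not_stopped[OF u(1) elim(2)] r'(1) by simp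
        moreover have "\<not> enat (Suc r) \<le> coding_radius d S \<omega> u"
          using st(2) unfolding le_coding_radius_iff by blast
        ultimately have "r' = r" using r'(1) by simp
        then show ?thesis using r'(2) st(3) by (simp add: minimal_piece_def)
      qed
      have "F \<in> \<D>" using piece[OF z] both by simp
      moreover have wF: "(+) w ` F \<in> \<D>" using piece[OF w] both by simp
      \<comment> \<open>Since \<open>a = w + b\<close>, the point \<open>a\<close> is on the
        boundary of both \<open>F\<close> and its translate.\<close>
      moreover have "a \<in> grid_boundary d ((+) w ` F)"
        using grid_boundary_translate[OF w ab(2)] by (simp add: w_def)
      moreover have "grid_dist d a a \<le> q"
        unfolding grid_dist_def using Least_le[of "\<lambda>n. (a, a) \<in> grid_edges d ^^ n" 0] by simp
      ultimately have "F = (+) w ` F" using \<D> ab(1) unfolding toast_def by blast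
      moreover have "F \<noteq> {}" using ab(1) by (auto simp: grid_boundary_def)
      ultimately show False
        using finite_translate_neq[OF F(1), of w] ab(3) by (simp add: w_def)
    qed
  qed
  ultimately show False by blast
qed

text \<open>There are only countably many triples of a vertex, a radius and a finite set, so the
  null events can be combined.\<close>

lemma AE_no_wide_output:
  assumes "constructs_toast d q S f"
  shows "AE \<omega> in labelling (grid d). \<forall>u\<in>grid d. \<forall>r. \<forall>F\<in>{F. finite F \<and> F \<subseteq> grid d}.
    (\<exists>a\<in>grid_boundary d F. \<exists>b\<in>grid_boundary d F. a 0 - b 0 > 2 * int r) \<longrightarrow>
    labelled_ball d \<omega> u r \<notin> stops_with d S f r F"
proof (intro AE_ball_countable' AE_all_countable[THEN iffD2] allI AE_impI countable_grid
    countable_Collect_finite_subset)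
  interpret prob_space "labelling (grid d)" by (rule prob_space_labelling)
  fix u r F
  assume u: "u \<in> grid d" and F: "F \<in> {F. finite F \<and> F \<subseteq> grid d}"
    and wide: "\<exists>a\<in>grid_boundary d F. \<exists>b\<in>grid_boundary d F. a 0 - b 0 > 2 * int r"
  have T: "stops_with d S f r F \<in> sets (labelling (grid_ball d 0 r))"
    using F by (intro sets_stops_with) auto
  have "\<P>(\<omega> in labelling (grid d). labelled_ball d \<omega> u r \<in> stops_with d S f r F) = 0"
    using wide F wide_output_null[OF assms] by (subst prob_labelled_ball[OF u T]) auto
  then have "AE \<omega> in labelling (grid d).
      \<omega> \<notin> {\<omega> \<in> space (labelling (grid d)). labelled_ball d \<omega> u r \<in> stops_with d S f r F}"
    by (subst (asm) prob_eq_0[OF sets_labelled_ball[OF u T]])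
  with AE_space show "AE \<omega> in labelling (grid d). labelled_ball d \<omega> u r \<notin> stops_with d S f r F"
    by eventually_elim blast
qed

text \<open>Some vertex of a segment of length \<open>2 * k\<close> has a piece of width at least
  \<open>2 * k\<close>, while almost surely the width is at most twice the radius.\<close>

lemma AE_large_radius_on_segment:
  assumes d: "d > 1" and q: "q \<ge> 1" and toast: "constructs_toast d q S f"
  shows "AE \<omega> in labelling (grid d). \<exists>i\<le>2 * k. enat k \<le> coding_radius d S \<omega> (axis_vertex (int i))"
  using toast[unfolded constructs_toast_def] AE_no_wide_output[OF toast] AE_space
proof eventually_elim
  case (elim \<omega>)
  have axis_vertex: "axis_vertex a \<in> grid d" for a using d by (simp add: axis_vertex_def grid_def)
  obtain \<D> where \<D>: "toast d q \<D>"
    and out: "\<And>u. u \<in> grid d \<Longrightarrow> \<exists>r. coding_radius d S \<omega> u = enat r \<and>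
       minimal_piece \<D> u ((+) u ` f r (labelled_ball d \<omega> u r))" using elim(1) by blast
  then obtain R where R: "\<And>u. u \<in> grid d \<Longrightarrow> coding_radius d S \<omega> u = enat (R u)"
    and out: "\<And>u. u \<in> grid d \<Longrightarrow> minimal_piece \<D> u ((+) u ` f (R u) (labelled_ball d \<omega> u (R u)))"
    by metis
  define F where "F u = f (R u) (labelled_ball d \<omega> u (R u))" for u
  define D where "D i = (+) (axis_vertex (int i)) ` F (axis_vertex (int i))" for i :: nat
  have "\<exists>i\<le>2 * k. \<exists>a\<in>grid_boundary d (D i). \<exists>b\<in>grid_boundary d (D i). a 0 - b 0 \<ge> int (2 * k)"
    using out[OF axis_vertex] by (intro toast_wide_piece[OF d q \<D>]) (auto simp: minimal_piece_def D_def F_def)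
  then obtain i a b where i: "i \<le> 2 * k"
    and ab: "a \<in> grid_boundary d (D i)" "b \<in> grid_boundary d (D i)" "a 0 - b 0 \<ge> int (2 * k)" by blast
  define u where "u = axis_vertex (int i)"
  have u: "u \<in> grid d" by (simp add: u_def axis_vertex)
  have mu: "- u \<in> grid d" using u by (simp add: grid_def)
  \<comment> \<open>Outputs are positioned relative to \<open>u\<close>; moving the piece back keeps
    the difference of its boundary points.\<close>
  have F_eq: "(+) (- u) ` D i = F u" by (simp add: D_def u_def image_image)
  have bd: "- u + a \<in> grid_boundary d (F u)" "- u + b \<in> grid_boundary d (F u)"
    using grid_boundary_translate[OF mu ab(1)] grid_boundary_translate[OF mu ab(2)]
    by (simp_all only: F_eq)
  have FF: "F u \<in> {F. finite F \<and> F \<subseteq> grid d}"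
    using output_finite[OF u elim(3)] by (simp add: F_def)
  have "labelled_ball d \<omega> u (R u) \<in> stops_with d S f (R u) (F u)"
    using labelled_ball_not_stopped[OF u elim(3), of "R u" S] coding_radius_stop R[OF u]
    by (auto simp: stops_with_def F_def)
  with elim(2) u FF have "\<not> (\<exists>a\<in>grid_boundary d (F u). \<exists>b\<in>grid_boundary d (F u). a 0 - b 0 > 2 * int (R u))"
    by blast
  with bd have "\<not> ((- u + a) 0 - (- u + b) 0 > 2 * int (R u))" by blast
  then have "k \<le> R u" using ab(3) by simp
  then show ?case using i R[OF u] by (intro exI[of _ i]) (simp add: u_def)
qed

text \<open>A union bound over the \<open>2 * k + 1\<close> vertices of the segment, all of which
  have the same tail probability.\<close>

lemma coding_radius_tail:
  assumes d: "d > 1" and q: "q \<ge> 1" and toast: "constructs_toast d q S f"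
  shows "\<P>(\<omega> in labelling (grid d). enat k \<le> coding_radius d S \<omega> 0) \<ge> 1 / (2 * real k + 1)"
proof -
  interpret prob_space "labelling (grid d)" by (rule prob_space_labelling)
  let ?M = "labelling (grid d)"
  let ?E = "\<lambda>u. {\<omega> \<in> space ?M. enat k \<le> coding_radius d S \<omega> u}"
  have E: "?E u = {\<omega> \<in> space ?M. labelled_ball d \<omega> u k \<in> not_stopped d S k}" if "u \<in> grid d" for u
    using labelled_ball_not_stopped[OF that] by auto
  have axis_vertex: "axis_vertex a \<in> grid d" for a using d by (simp add: axis_vertex_def grid_def)
  have z: "0 \<in> grid d" by (simp add: grid_def)
  have sets: "?E u \<in> sets ?M" if "u \<in> grid d" for u
    unfolding E[OF that] by (rule sets_labelled_ball[OF that sets_not_stopped])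
  have prob: "prob (?E u) = prob (?E 0)" if "u \<in> grid d" for u
    unfolding E[OF that] E[OF z] prob_labelled_ball[OF that sets_not_stopped]
      prob_labelled_ball[OF z sets_not_stopped] ..
  have "AE \<omega> in ?M. \<omega> \<in> (\<Union>i\<le>2 * k. ?E (axis_vertex (int i)))"
    using AE_large_radius_on_segment[OF assms] AE_space by eventually_elim auto
  then have "1 = prob (\<Union>i\<le>2 * k. ?E (axis_vertex (int i)))"
    using sets[OF axis_vertex] by (subst prob_eq_1[THEN iffD2]) auto
  also have "\<dots> \<le> (\<Sum>i\<le>2 * k. prob (?E (axis_vertex (int i))))"
    using sets[OF axis_vertex] by (intro finite_measure_subadditive_finite) auto
  also have "\<dots> = (2 * real k + 1) * prob (?E 0)"
    by (simp add: prob[OF axis_vertex])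
  finally show ?thesis by (simp add: field_simps)
qed

end

section \<open>Comparison with the complexity C/eps\<close>

lemma less_coding_radius_iff:
  assumes "t \<ge> 0"
  shows "ereal t < ereal_of_enat R \<longleftrightarrow> enat (nat \<lfloor>t\<rfloor> + 1) \<le> R"
proof (cases R)
  case (enat n)
  then show ?thesis using assms by (simp add: Suc_le_eq) linarith
qed simp

theorem corollary5p3:
  "\<exists>C::real. C > 0 \<and>
     (\<forall>d::nat. d > 1 \<longrightarrow> (\<forall>q::nat. q \<ge> 1 \<longrightarrow>
        \<not> (\<exists>S f. uniform_local_algorithm d (count_space {D. finite D \<and> D \<subseteq> grid d}) S f \<and>
                 constructs_toast d q S f \<and>
                 has_uniform_complexity d S (\<lambda>\<epsilon>. C / \<epsilon>))))"
\<comment> \<open>For \<open>C = 1/4\<close> the tail bound leads to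
  \<open>1 \<le> 2 * C + 3 * \<epsilon> = 1/2 + 3 * \<epsilon>\<close>, which fails for
  \<open>\<epsilon> < 1/6\<close>.\<close>
proof (intro exI[of _ "1/4"] conjI allI impI notI)
  fix d q :: nat
  assume d: "d > 1" and q: "q \<ge> 1"
  assume "\<exists>S f. uniform_local_algorithm d (count_space {D. finite D \<and> D \<subseteq> grid d}) S f \<and>
                 constructs_toast d q S f \<and> has_uniform_complexity d S (\<lambda>\<epsilon>. 1 / 4 / \<epsilon>)"
  then obtain S f where alg: "uniform_local_algorithm d (count_space {D. finite D \<and> D \<subseteq> grid d}) S f"
    and toast: "constructs_toast d q S f"
    and fast: "has_uniform_complexity d S (\<lambda>\<epsilon>. 1 / 4 / \<epsilon>)" by blast
  have "\<forall>\<^sub>F \<epsilon> in at_right 0. 0 < \<epsilon> \<and> \<epsilon> < (1/6 :: real)"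
    using eventually_at_right_real[of 0 "1/6 :: real"] by (auto elim: eventually_mono)
  with fast[unfolded has_uniform_complexity_def]
  have "\<forall>\<^sub>F \<epsilon> :: real in at_right 0. False"
  proof eventually_elim
    case (elim \<epsilon>)
    \<comment> \<open>The least integer exceeding \<open>1 / 4 / \<epsilon>\<close>, so that a
      radius above this bound is one of at least \<open>k\<close>.\<close>
    define k where "k = nat \<lfloor>1 / 4 / \<epsilon>\<rfloor> + 1"
    have "\<P>(\<omega> in labelling (grid d). enat k \<le> coding_radius d S \<omega> 0) \<le> \<epsilon>"
      using elim by (subst (asm) less_coding_radius_iff) (auto simp: k_def)
    then have "1 / (2 * real k + 1) \<le> \<epsilon>" using coding_radius_tail[OF alg d q toast, of k] by simp
    then have "1 \<le> \<epsilon> * (2 * real k + 1)" by (simp add: field_simps)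
    also have "real k \<le> 1 / 4 / \<epsilon> + 1" using elim unfolding k_def by simp
    then have "\<epsilon> * (2 * real k + 1) \<le> \<epsilon> * (2 * (1 / 4 / \<epsilon> + 1) + 1)"
      using elim by (intro mult_left_mono) auto
    also have "\<dots> = 1 / 2 + 3 * \<epsilon>" using elim by (simp add: field_simps)
    finally show False using elim by simp
  qed
  then show False by simp
qed simp

end
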